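(* Let $\Phi$ be a root system of type $D_n$ ($n\ge 4$), $E_6$, $E_7$ or $E_8$, with simple roots $\Pi$ and positive roots $\Phi^+$, and for $t\ge1$ let $\mathcal{I}_t=\{\alpha\in\Phi^+:\mathrm{ht}(\alpha)\ge t\}$. Let $\mathcal{I}$ be an ideal of $\Phi^+$. Then: (i) if $\mathcal{I}\subseteq\mathcal{I}_4$, then $\mathcal{A}_\mathcal{I}$ is not supersolvable; (ii) if $\mathcal{I}\subseteq\mathcal{I}_5$, then $\mathcal{A}_\mathcal{I}$ is not inductively factored.
   Context: Heights $\mathrm{ht}(\sum_{\alpha\in\Pi}c_\alpha\alpha)=\sum c_\alpha$. An ideal of $\Phi^+$ is $\mathcal{I}\subseteq\Phi^+$ with $\alpha\in\mathcal{I},\beta\in\Phi^+,\alpha+\beta\in\Phi^+\Rightarrow\alpha+\beta\in\mathcal{I}$; $\mathcal{I}^c=\Phi^+\setminus\mathcal{I}$; $H_\alpha$ the hyperplane orthogonal to $\alpha$ in $V=\mathbb{R}\otimes\mathbb{Z}\Phi$; $\mathcal{A}_\mathcal{I}=\{H_\alpha:\alpha\in\mathcal{I}^c\}$. For a central arrangement $\mathcal{A}$: $L(\mathcal{A})$ = intersections of subsets of $\mathcal{A}$, ordered by reverse inclusion, rank = codimension; $X\in L(\mathcal{A})$ is modular if $X+Y\in L(\mathcal{A})$ for all $Y\in L(\mathcal{A})$; $\mathcal{A}$ is supersolvable if there is a maximal chain $V=X_0<\cdots<X_r=\bigcap_{H\in\mathcal{A}}H$ of modular elements. Inductively factored: the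 class of pairs $(\mathcal{A},\pi)$, $\pi=(\pi_1,\ldots,\pi_s)$ an ordered partition of $\mathcal{A}$, is the smallest class containing $(\varnothing,())$ in every dimension and containing $(\mathcal{A},\pi)$ whenever some $H_0\in\pi_1$ makes $\mathcal{A}\setminus\pi_1\to\mathcal{A}''$, $H\mapsto H\cap H_0$, bijective (where $\mathcal{A}'=\mathcal{A}\setminus\{H_0\}$, $\mathcal{A}''=\{H_0\cap H:H\in\mathcal{A}'\}$) and $(\mathcal{A}',\pi')$, $(\mathcal{A}'',\pi'')$ are in the class, with $\pi'$ the nonempty $\pi_i\cap\mathcal{A}'$ and $\pi''=(\{H\cap H_0:H\in\pi_i\})_{i=2}^s$; $\mathcal{A}$ is inductively factored if some such $\pi$ exists. *)

theory Defs
  imports "HOL-Analysis.Analysis" "HOL-Library.Set_Algebras" "HOL-Library.Disjoint_Sets"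
begin

section \<open>Root systems\<close>

definition cartan_int :: "'a::euclidean_space \<Rightarrow> 'a \<Rightarrow> real" where
  "cartan_int \<alpha> \<beta> = 2 * (\<alpha> \<bullet> \<beta>) / (\<beta> \<bullet> \<beta>)"

text \<open>
  Reduced crystallographic root systems. The set \<open>\<Phi>\<close> need not span the type \<open>'a\<close>: the vector
  space that carries the root system is \<open>span \<Phi>\<close>.
\<close>

definition root_system :: "'a::euclidean_space set \<Rightarrow> bool" where
  "root_system \<Phi> \<longleftrightarrow>
     finite \<Phi> \<and> 0 \<notin> \<Phi> \<and>
     (\<forall>\<alpha>\<in>\<Phi>. \<forall>\<beta>\<in>\<Phi>. \<alpha> - cartan_int \<alpha> \<beta> *\<^sub>R \<beta> \<in> \<Phi>) \<and>
     (\<forall>\<alpha>\<in>\<Phi>. \<forall>\<beta>\<in>\<Phi>. cartan_int \<alpha> \<beta> \<in> \<int>) \<and>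
     (\<forall>\<alpha>\<in>\<Phi>. \<forall>c. c *\<^sub>R \<alpha> \<in> \<Phi> \<longrightarrow> c = 1 \<or> c = -1)"

definition simple_roots :: "'a::euclidean_space set \<Rightarrow> 'a set \<Rightarrow> bool" where
  "simple_roots \<Phi> \<Delta> \<longleftrightarrow>
     \<Delta> \<subseteq> \<Phi> \<and> independent \<Delta> \<and>
     (\<forall>\<alpha>\<in>\<Phi>. \<exists>c :: 'a \<Rightarrow> nat.
        \<alpha> = (\<Sum>\<beta>\<in>\<Delta>. real (c \<beta>) *\<^sub>R \<beta>) \<or> \<alpha> = - (\<Sum>\<beta>\<in>\<Delta>. real (c \<beta>) *\<^sub>R \<beta>))"

definition positive_roots :: "'a::euclidean_space set \<Rightarrow> 'a set \<Rightarrow> 'a set" where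
  "positive_roots \<Phi> \<Delta> = {\<alpha> \<in> \<Phi>. \<forall>\<beta>\<in>\<Delta>. representation \<Delta> \<alpha> \<beta> \<ge> 0}"

definition ht :: "'a::euclidean_space set \<Rightarrow> 'a \<Rightarrow> real" where
  "ht \<Delta> \<alpha> = (\<Sum>\<beta>\<in>\<Delta>. representation \<Delta> \<alpha> \<beta>)"

text \<open>
  The Dynkin diagram of \<open>\<Delta>\<close> is the simple graph with vertices \<open>{1..n}\<close> and edge set \<open>E\<close>, all edges
  being simple bonds; equivalently, the Cartan matrix has entries \<open>-1\<close> for joined vertices and
  \<open>0\<close> for distinct vertices that are not joined.
\<close>

definition has_dynkin_diagram :: "'a::euclidean_space set \<Rightarrow> nat \<Rightarrow> nat set set \<Rightarrow> bool" where
  "has_dynkin_diagram \<Delta> n E \<longleftrightarrow>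
     (\<exists>a. bij_betw a {1..n} \<Delta> \<and>
       (\<forall>i\<in>{1..n}. \<forall>j\<in>{1..n}. i \<noteq> j \<longrightarrow>
          cartan_int (a i) (a j) = (if {i, j} \<in> E then -1 else 0)))"

text \<open>Both diagrams carry the Bourbaki labelling. The second one is used for \<open>n = 6, 7, 8\<close>.\<close>

definition D_edges :: "nat \<Rightarrow> nat set set" where
  "D_edges n = {{i, i + 1} |i. 1 \<le> i \<and> i \<le> n - 2} \<union> {{n - 2, n}}"

definition E_edges :: "nat \<Rightarrow> nat set set" where
  "E_edges n = {{1, 3}, {2, 4}} \<union> {{i, i + 1} |i. 3 \<le> i \<and> i \<le> n - 1}"

definition root_ideal :: "'a::euclidean_space set \<Rightarrow> 'a set \<Rightarrow> 'a set \<Rightarrow> bool" where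
  "root_ideal \<Phi> \<Delta> I \<longleftrightarrow>
     I \<subseteq> positive_roots \<Phi> \<Delta> \<and>
     (\<forall>\<alpha>\<in>I. \<forall>\<beta>\<in>positive_roots \<Phi> \<Delta>. \<alpha> + \<beta> \<in> positive_roots \<Phi> \<Delta> \<longrightarrow> \<alpha> + \<beta> \<in> I)"

definition height_ideal :: "'a::euclidean_space set \<Rightarrow> 'a set \<Rightarrow> nat \<Rightarrow> 'a set" where
  "height_ideal \<Phi> \<Delta> t = {\<alpha> \<in> positive_roots \<Phi> \<Delta>. ht \<Delta> \<alpha> \<ge> real t}"

definition root_hyperplane :: "'a::euclidean_space set \<Rightarrow> 'a \<Rightarrow> 'a set" where
  "root_hyperplane \<Phi> \<alpha> = {v \<in> span \<Phi>. v \<bullet> \<alpha> = 0}"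

definition ideal_arrangement ::
    "'a::euclidean_space set \<Rightarrow> 'a set \<Rightarrow> 'a set \<Rightarrow> 'a set set" where
  "ideal_arrangement \<Phi> \<Delta> I = root_hyperplane \<Phi> ` (positive_roots \<Phi> \<Delta> - I)"

section \<open>Central arrangements\<close>

text \<open>
  The ambient space of an arrangement is an explicit subspace \<open>V\<close> of the type \<open>'a\<close>, because
  restrictions live in the hyperplane to which one restricts.
\<close>

definition central_arrangement :: "'a::euclidean_space set \<Rightarrow> 'a set set \<Rightarrow> bool" where
  "central_arrangement V A \<longleftrightarrow>
     subspace V \<and> finite A \<and> (\<forall>H\<in>A. subspace H \<and> H \<subseteq> V \<and> dim H + 1 = dim V)"

text \<open>Intersecting with \<open>V\<close> only serves to make the empty intersection equal to \<open>V\<close>.\<close>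

definition intersection_lattice :: "'a::euclidean_space set \<Rightarrow> 'a set set \<Rightarrow> 'a set set" where
  "intersection_lattice V A = {V \<inter> \<Inter>B |B. B \<subseteq> A}"

definition modular_element :: "'a::euclidean_space set \<Rightarrow> 'a set set \<Rightarrow> 'a set \<Rightarrow> bool" where
  "modular_element V A X \<longleftrightarrow>
     X \<in> intersection_lattice V A \<and>
     (\<forall>Y\<in>intersection_lattice V A. X + Y \<in> intersection_lattice V A)"

text \<open>
  The lattice is ordered by reverse inclusion; maximal chains for inclusion and for reverse
  inclusion are the same sets.
\<close>

definition supersolvable :: "'a::euclidean_space set \<Rightarrow> 'a set set \<Rightarrow> bool" where
  "supersolvable V A \<longleftrightarrow>
     (\<exists>(X :: nat \<Rightarrow> 'a set) r.
        X 0 = V \<and> X r = V \<inter> \<Inter>A \<and>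
        (\<forall>i<r. X (Suc i) \<subset> X i) \<and>
        subset.maxchain (intersection_lattice V A) (X ` {..r}) \<and>
        (\<forall>i\<le>r. modular_element V A (X i)))"

definition ordered_partition :: "'b set \<Rightarrow> 'b set list \<Rightarrow> bool" where
  "ordered_partition A \<pi> \<longleftrightarrow> distinct \<pi> \<and> partition_on A (set \<pi>)"

text \<open>
  \<open>ind_factored_pair V A \<pi>\<close>: the pair \<open>(A, \<pi>)\<close> of an arrangement in \<open>V\<close> and an ordered partition
  \<open>\<pi> = (P, Q\<^sub>2, \<dots>, Q\<^sub>s)\<close> of it belongs to the class of inductively factored pairs. The lists in the
  last two premises are the partitions induced on the deletion and on the restriction.
\<close>

inductive ind_factored_pair ::
    "'a::euclidean_space set \<Rightarrow> 'a set set \<Rightarrow> 'a set set list \<Rightarrow> bool" where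
  empty: "subspace V \<Longrightarrow> ind_factored_pair V {} []"
| step: "\<lbrakk>central_arrangement V A; ordered_partition A (P # Q); H0 \<in> P;
     A' = A - {H0}; A'' = (\<lambda>H. H \<inter> H0) ` A';
     bij_betw (\<lambda>H. H \<inter> H0) (A - P) A'';
     ind_factored_pair V A' (filter (\<lambda>B. B \<noteq> {}) (map (\<lambda>B. B \<inter> A') (P # Q)));
     ind_factored_pair H0 A'' (map (\<lambda>B. (\<lambda>H. H \<inter> H0) ` B) Q)\<rbrakk>
   \<Longrightarrow> ind_factored_pair V A (P # Q)"

definition inductively_factored :: "'a::euclidean_space set \<Rightarrow> 'a set set \<Rightarrow> bool" where
  "inductively_factored V A \<longleftrightarrow> (\<exists>\<pi>. ind_factored_pair V A \<pi>)"

end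

theory Submission
  imports Defs
begin

text \<open>
  All the diagrams contain a star \<open>D\<^sub>4\<close>, whose twelve positive roots fall into three frames of four
  pairwise orthogonal roots. Roots of equal length cannot lie in the plane of two orthogonal roots
  other than as these roots or their negatives, so two orthogonal roots span a rank-two flat with
  just two hyperplanes. A supersolvable chain, and likewise an inductive factorization, divides the
  hyperplanes through the rank-four flat of the star into at most four classes such that no two
  members of a class span such a flat.

  If all roots of height at most 4 survive, two frames are complete and each of them meets all four
  classes, so every class has at least two members; but an inductive factorization meets every
  nontrivial localization in a singleton class. If only height at most 3 is guaranteed, one
  frame is complete and another one retains three roots. The bottom class of a supersolvable chain
  is a singleton; the second class contains a root from either frame, and the plane spanned by these
  two would have to contain the bottom root, which linear algebra excludes.
\<close>

section \<open>Roots and simple roots\<close>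

lemma reflection_inner_self:
  "\<beta> \<noteq> 0 \<Longrightarrow> (\<alpha> - cartan_int \<alpha> \<beta> *\<^sub>R \<beta>) \<bullet> (\<alpha> - cartan_int \<alpha> \<beta> *\<^sub>R \<beta>) = \<alpha> \<bullet> \<alpha>"
  by (simp add: cartan_int_def inner_diff_left inner_diff_right inner_commute[of \<beta> \<alpha>]
      right_diff_distrib)

lemma simple_roots_span:
  assumes "simple_roots \<Phi> \<Delta>" "\<alpha> \<in> \<Phi>"
  shows "\<alpha> \<in> span \<Delta>"
proof -
  have "(\<Sum>\<beta>\<in>\<Delta>. real (c \<beta>) *\<^sub>R \<beta>) \<in> span \<Delta>" for c :: "'a \<Rightarrow> nat"
    by (intro span_sum span_scale span_base)
  then show ?thesis
    using assms span_neg unfolding simple_roots_def by metis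
qed

text \<open>Positivity is defined through coordinates, whereas \<open>simple_roots\<close> only
  supplies sums with natural coefficients; independence of \<open>\<Delta>\<close> makes these
  coefficients the coordinates. The negative of a root is a root because it is the reflection of the
  root in itself.\<close>

lemma root_representation_sign:
  assumes "root_system \<Phi>" "simple_roots \<Phi> \<Delta>" "\<alpha> \<in> \<Phi>"
  shows "\<alpha> \<in> positive_roots \<Phi> \<Delta> \<or> - \<alpha> \<in> positive_roots \<Phi> \<Delta>"
    and "- \<alpha> \<in> \<Phi>"
proof -
  have fin: "finite \<Delta>" and ind: "independent \<Delta>"
    using assms finite_subset by (auto simp: simple_roots_def root_system_def)
  have "\<alpha> \<noteq> 0" "\<alpha> - cartan_int \<alpha> \<alpha> *\<^sub>R \<alpha> \<in> \<Phi>"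
    using assms by (auto simp: root_system_def)
  then show neg: "- \<alpha> \<in> \<Phi>"
    by (simp add: cartan_int_def scaleR_2)
  have rep: "representation \<Delta> (\<Sum>\<beta>\<in>\<Delta>. real (c \<beta>) *\<^sub>R \<beta>) \<beta> = real (c \<beta>)" if "\<beta> \<in> \<Delta>" for c \<beta>
  proof -
    have "representation \<Delta> (\<Sum>\<beta>\<in>\<Delta>. real (c \<beta>) *\<^sub>R \<beta>) \<beta>
        = (\<Sum>b\<in>\<Delta>. real (c b) * representation \<Delta> b \<beta>)"
      using ind by (simp add: representation_sum representation_scale span_base span_scale)
    also have "\<dots> = (\<Sum>b\<in>\<Delta>. if b = \<beta> then real (c b) else 0)"
      using ind by (intro sum.cong) (auto simp: representation_basis)
    finally show ?thesis using that fin by simp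
  qed
  obtain c :: "'a \<Rightarrow> nat" where
    "\<alpha> = (\<Sum>\<beta>\<in>\<Delta>. real (c \<beta>) *\<^sub>R \<beta>) \<or> - \<alpha> = (\<Sum>\<beta>\<in>\<Delta>. real (c \<beta>) *\<^sub>R \<beta>)"
    using assms(2,3) unfolding simple_roots_def by (metis minus_minus)
  then show "\<alpha> \<in> positive_roots \<Phi> \<Delta> \<or> - \<alpha> \<in> positive_roots \<Phi> \<Delta>"
    using rep neg assms(3) unfolding positive_roots_def by auto
qed

lemma representation_reflection:
  assumes "root_system \<Phi>" "simple_roots \<Phi> \<Delta>" "\<gamma> \<in> \<Phi>" "\<beta> \<in> \<Delta>"
  shows "representation \<Delta> (\<gamma> - k *\<^sub>R \<beta>) \<delta> = representation \<Delta> \<gamma> \<delta> - (if \<delta> = \<beta> then k else 0)"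
  using assms simple_roots_span[OF assms(2,3)]
  by (auto simp: simple_roots_def representation_diff representation_scale representation_basis
      span_base span_scale)

text \<open>Descent on the height: since \<open>\<gamma> \<bullet> \<gamma> > 0\<close>, some simple
  root has both a positive coordinate in \<gamma> and a positive inner product with it. Reflecting
  in that root keeps the length and lowers the height by a positive integer. Working inside
  \<open>span \<Gamma>\<close> means that only the lengths of the simple roots in \<Gamma> enter.
  The number \<open>n\<close> is a bound because \<open>ht\<close> is real-valued.\<close>

lemma positive_root_inner_self:
  assumes rs: "root_system \<Phi>" and sr: "simple_roots \<Phi> \<Delta>" and sub: "\<Gamma> \<subseteq> \<Delta>"
    and N: "\<And>\<beta>. \<beta> \<in> \<Gamma> \<Longrightarrow> \<beta> \<bullet> \<beta> = N"
    and "\<gamma> \<in> positive_roots \<Phi> \<Delta>" "\<gamma> \<in> span \<Gamma>" "ht \<Delta> \<gamma> \<le> real n"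
  shows "\<gamma> \<bullet> \<gamma> = N"
  using assms(5-7)
proof (induction n arbitrary: \<gamma>)
  let ?r = "representation \<Delta>"
  have fin: "finite \<Delta>" and ind: "independent \<Delta>" and D: "\<Delta> \<subseteq> \<Phi>"
    using rs sr finite_subset by (auto simp: simple_roots_def root_system_def)
  have expand: "(\<Sum>\<beta>\<in>\<Delta>. ?r \<gamma> \<beta> *\<^sub>R \<beta>) = \<gamma>" if "\<gamma> \<in> \<Phi>" for \<gamma>
    using sum_representation_eq[OF ind simple_roots_span[OF sr that] fin] by simp
  {
    case 0
    then have "\<forall>\<beta>\<in>\<Delta>. ?r \<gamma> \<beta> = 0"
      using fin sum_nonneg_eq_0_iff[of \<Delta> "?r \<gamma>"] sum_nonneg[of \<Delta> "?r \<gamma>"]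
      by (force simp: ht_def positive_roots_def)
    then have "\<gamma> = 0"
      using expand[of \<gamma>] 0 by (simp add: positive_roots_def)
    then show ?case
      using 0 rs by (simp add: root_system_def positive_roots_def)
  next
    case (Suc n)
    then have g: "\<gamma> \<in> \<Phi>" and pos: "\<And>\<beta>. \<beta> \<in> \<Delta> \<Longrightarrow> ?r \<gamma> \<beta> \<ge> 0"
      by (auto simp: positive_roots_def)
    have "\<gamma> \<noteq> 0"
      using g rs by (auto simp: root_system_def)
    then have "0 < \<gamma> \<bullet> (\<Sum>\<beta>\<in>\<Delta>. ?r \<gamma> \<beta> *\<^sub>R \<beta>)"
      using expand[OF g] by simp
    also have "\<dots> = (\<Sum>\<beta>\<in>\<Delta>. ?r \<gamma> \<beta> * (\<gamma> \<bullet> \<beta>))"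
      by (simp add: inner_sum_right)
    finally obtain \<beta> where b: "\<beta> \<in> \<Delta>" "0 < ?r \<gamma> \<beta> * (\<gamma> \<bullet> \<beta>)"
      by (meson not_less sum_nonpos)
    then have gb: "?r \<gamma> \<beta> > 0" "\<gamma> \<bullet> \<beta> > 0"
      using pos[of \<beta>] by (auto simp: zero_less_mult_iff)
    \<comment> \<open>A vector of \<open>span \<Gamma>\<close> has zero coordinates outside
      \<Gamma>.\<close>
    have bG: "\<beta> \<in> \<Gamma>"
      using gb(1) representation_extend[OF ind Suc.prems(2) sub] representation_ne_zero
      by (metis less_irrefl)
    have b0: "\<beta> \<noteq> 0" using gb by auto
    define k where "k = cartan_int \<gamma> \<beta>"
    define \<gamma>' where "\<gamma>' = \<gamma> - k *\<^sub>R \<beta>"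
    have "k > 0" "k \<in> \<int>"
      using rs g b D gb b0 by (auto simp: k_def cartan_int_def root_system_def)
    then have k: "k \<ge> 1"
      by (auto elim!: Ints_cases)
    have g': "\<gamma>' \<in> \<Phi>"
      using rs g b D by (auto simp: root_system_def \<gamma>'_def k_def)
    have norm: "\<gamma>' \<bullet> \<gamma>' = \<gamma> \<bullet> \<gamma>"
      unfolding \<gamma>'_def k_def using b0 by (rule reflection_inner_self)
    have sp: "\<gamma>' \<in> span \<Gamma>"
      unfolding \<gamma>'_def using Suc.prems(2) span_base[OF bG] by (intro span_diff span_scale)
    have rep: "?r \<gamma>' \<delta> = ?r \<gamma> \<delta> - (if \<delta> = \<beta> then k else 0)" for \<delta>
      unfolding \<gamma>'_def by (rule representation_reflection[OF rs sr g b(1)])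
    show ?case
    proof (cases "\<gamma>' \<in> positive_roots \<Phi> \<Delta>")
      case True
      have "ht \<Delta> \<gamma>' = ht \<Delta> \<gamma> - k"
        unfolding ht_def rep using fin b by (simp add: sum_subtractf)
      then have "ht \<Delta> \<gamma>' \<le> real n"
        using k Suc.prems(3) by simp
      then show ?thesis
        using Suc.IH[OF True sp] norm by simp
    next
      \<comment> \<open>Away from \<beta> the coordinates of \<open>\<gamma>'\<close> are those of
        \<gamma>, hence nonnegative; a negative \<open>\<gamma>'\<close> forces them to vanish. So
        \<gamma> is a multiple of \<beta>, and reducedness leaves \<beta> itself.\<close>
      case False
      then have neg: "- \<gamma>' \<in> positive_roots \<Phi> \<Delta>"
        using root_representation_sign[OF rs sr g'] by blast
      have "?r (- \<gamma>') \<delta> = - ?r \<gamma>' \<delta>" for \<delta>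
        using representation_neg[OF ind simple_roots_span[OF sr g']] by simp
      then have "?r \<gamma> \<delta> = 0" if "\<delta> \<in> \<Delta> - {\<beta>}" for \<delta>
        using neg pos[of \<delta>] rep[of \<delta>] that unfolding positive_roots_def
        by (smt (verit) DiffD1 DiffD2 mem_Collect_eq singletonI)
      then have "(\<Sum>\<delta>\<in>\<Delta>. ?r \<gamma> \<delta> *\<^sub>R \<delta>) = ?r \<gamma> \<beta> *\<^sub>R \<beta>"
        using fin b by (subst sum.remove[of _ \<beta>]) auto
      then have eq: "\<gamma> = ?r \<gamma> \<beta> *\<^sub>R \<beta>"
        using expand[OF g] by simp
      then have "?r \<gamma> \<beta> = 1 \<or> ?r \<gamma> \<beta> = -1"
        using rs g b D unfolding root_system_def by (metis subsetD)
      then have "\<gamma> = \<beta>" using eq gb by auto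
      then show ?thesis using N bG by simp
    qed
  }
qed

lemma root_inner_self:
  assumes "root_system \<Phi>" "simple_roots \<Phi> \<Delta>" "\<Gamma> \<subseteq> \<Delta>"
    and "\<And>\<beta>. \<beta> \<in> \<Gamma> \<Longrightarrow> \<beta> \<bullet> \<beta> = N" and "\<gamma> \<in> \<Phi>" "\<gamma> \<in> span \<Gamma>"
  shows "\<gamma> \<bullet> \<gamma> = N"
proof -
  have *: "\<delta> \<bullet> \<delta> = N" if "\<delta> \<in> positive_roots \<Phi> \<Delta>" "\<delta> \<in> span \<Gamma>" for \<delta>
    using positive_root_inner_self[OF assms(1-4) that] real_arch_simple by blast
  show ?thesis
    using root_representation_sign[OF assms(1,2,5)] *[of \<gamma>] *[of "- \<gamma>"] assms(6) span_neg by auto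
qed

text \<open>In type \<open>B\<^sub>2\<close> a long root is the sum of two orthogonal short roots; hence the length hypothesis.\<close>

lemma orthogonal_roots_span:
  assumes rs: "root_system \<Phi>" and "\<alpha> \<in> \<Phi>" "\<beta> \<in> \<Phi>" "\<gamma> \<in> \<Phi>" "\<alpha> \<bullet> \<beta> = 0"
    and eq: "\<alpha> \<bullet> \<alpha> = N" "\<beta> \<bullet> \<beta> = N" "\<gamma> \<bullet> \<gamma> = N" and "\<gamma> \<in> span {\<alpha>, \<beta>}"
  shows "\<gamma> \<in> {\<alpha>, - \<alpha>, \<beta>, - \<beta>}"
proof -
  obtain p q where g: "\<gamma> = p *\<^sub>R \<alpha> + q *\<^sub>R \<beta>"
    using assms(9) by (auto simp: span_insert algebra_simps)
  have N: "N \<noteq> 0"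
    using rs assms(2) eq by (auto simp: root_system_def)
  \<comment> \<open>The doubled coordinates are Cartan integers, and equality of lengths makes their
    squares add up to 4. The only integer solutions have one entry 0 and the other 2 or -2.\<close>
  have "cartan_int \<gamma> \<alpha> = 2 * p" "cartan_int \<gamma> \<beta> = 2 * q"
    using N eq(1,2) \<open>\<alpha> \<bullet> \<beta> = 0\<close>
    by (simp_all add: g cartan_int_def inner_add_left inner_commute[of \<beta> \<alpha>])
  then have "2 * p \<in> \<int>" "2 * q \<in> \<int>"
    using rs assms(2-4) by (metis root_system_def)+
  then obtain i j :: int where ij: "2 * p = of_int i" "2 * q = of_int j"
    by (auto elim!: Ints_cases)
  have "N * (p\<^sup>2 + q\<^sup>2) = N"
    using eq \<open>\<alpha> \<bullet> \<beta> = 0\<close>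
    by (simp add: g inner_add_left inner_add_right inner_commute power2_eq_square algebra_simps)
  then have "p\<^sup>2 + q\<^sup>2 = 1" using N by simp
  then have "(2 * p)\<^sup>2 + (2 * q)\<^sup>2 = 4" by (simp add: power_mult_distrib)
  then have "of_int (i\<^sup>2 + j\<^sup>2) = (of_int 4 :: real)" by (simp add: ij)
  then have sq: "i\<^sup>2 + j\<^sup>2 = 4" by linarith
  then have "\<bar>i\<bar>\<^sup>2 \<le> 2\<^sup>2" "\<bar>j\<bar>\<^sup>2 \<le> 2\<^sup>2" by (simp_all, (smt (verit) zero_le_power2)+)
  then have "\<bar>i\<bar> \<le> 2" "\<bar>j\<bar> \<le> 2" by (auto intro: power2_le_imp_le)
  then have "i \<in> {-2,-1,0,1,2}" "j \<in> {-2,-1,0,1,2}" by auto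
  then have "(i = 0 \<and> (j = 2 \<or> j = -2)) \<or> (j = 0 \<and> (i = 2 \<or> i = -2))"
    using sq by auto
  then show ?thesis using g ij by auto
qed

text \<open>Turns inclusions between flats into linear dependence of normals. The component
  \<open>z\<close> of \<gamma> orthogonal to \<open>span S\<close> lies in \<open>V\<close> and is
  orthogonal to \<open>S\<close>; so it is orthogonal to \<gamma>, hence to itself.\<close>

lemma in_span_if_hyperplanes:
  fixes V :: "'a::euclidean_space set"
  assumes "subspace V" "S \<subseteq> V" "\<gamma> \<in> V"
    and "\<And>v. v \<in> V \<Longrightarrow> (\<And>\<alpha>. \<alpha> \<in> S \<Longrightarrow> v \<bullet> \<alpha> = 0) \<Longrightarrow> v \<bullet> \<gamma> = 0"
  shows "\<gamma> \<in> span S"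
proof -
  obtain y z where y: "y \<in> span S" and z: "\<And>w. w \<in> span S \<Longrightarrow> orthogonal z w" and yz: "\<gamma> = y + z"
    using orthogonal_subspace_decomp_exists[of S \<gamma>] by blast
  have "y \<in> V" using y assms(1,2) span_minimal by blast
  then have "z \<in> V" using yz assms(1,3) subspace_diff[of V \<gamma> y] by simp
  moreover have "z \<bullet> \<alpha> = 0" if "\<alpha> \<in> S" for \<alpha>
    using z that span_base by (auto simp: orthogonal_def)
  ultimately have "z \<bullet> \<gamma> = 0" by (rule assms(4))
  then have "z \<bullet> z = 0"
    using z[OF y] by (simp add: yz inner_add_right orthogonal_def)
  then show ?thesis using y yz by simp
qed

text \<open>Each normal vector cuts the dimension by at most one. Applied to the four simple roots
  of the star, this bounds the codimension of its flat.\<close>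

lemma dim_orthogonal_finite:
  fixes V :: "'a::euclidean_space set"
  assumes "subspace V" "finite S" "S \<subseteq> V"
  shows "dim V \<le> dim {v \<in> V. \<forall>s\<in>S. v \<bullet> s = 0} + card S"
proof -
  let ?U = "{v \<in> V. \<forall>s\<in>span S. orthogonal s v}" and ?W = "{v \<in> V. \<forall>s\<in>S. v \<bullet> s = 0}"
  have "?U \<subseteq> ?W"
    using span_base by (auto simp: orthogonal_def inner_commute)
  then have "dim ?U \<le> dim ?W" by (rule dim_subset)
  moreover have "dim ?U + dim (span S) = dim V"
    using assms by (intro dim_subspace_orthogonal_to_vectors) (auto simp: span_minimal)
  moreover have "dim (span S) \<le> card S"
    using assms(2) by (intro dim_le_card) auto
  ultimately show ?thesis by linarith
qed

text \<open>Lets hyperplanes be identified with positive roots. Equal hyperplanes have proportional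
  normals, reducedness leaves a sign, and two opposite positive roots would have only zero
  coordinates.\<close>

lemma inj_on_root_hyperplane:
  assumes "root_system \<Phi>" "simple_roots \<Phi> \<Delta>"
  shows "inj_on (root_hyperplane \<Phi>) (positive_roots \<Phi> \<Delta>)"
proof (rule inj_onI)
  fix \<alpha> \<beta> assume *: "\<alpha> \<in> positive_roots \<Phi> \<Delta>" "\<beta> \<in> positive_roots \<Phi> \<Delta>"
    "root_hyperplane \<Phi> \<alpha> = root_hyperplane \<Phi> \<beta>"
  let ?r = "representation \<Delta>"
  have ab: "\<alpha> \<in> \<Phi>" "\<beta> \<in> \<Phi>" using * by (auto simp: positive_roots_def)
  have "\<beta> \<in> span {\<alpha>}"
  proof (rule in_span_if_hyperplanes)
    show "subspace (span \<Phi>)" "{\<alpha>} \<subseteq> span \<Phi>" "\<beta> \<in> span \<Phi>"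
      using ab span_base by (auto intro: subspace_span)
    show "v \<bullet> \<beta> = 0" if "v \<in> span \<Phi>" "\<And>\<delta>. \<delta> \<in> {\<alpha>} \<Longrightarrow> v \<bullet> \<delta> = 0" for v
      using *(3) that unfolding root_hyperplane_def by blast
  qed
  then obtain p where p: "\<beta> = p *\<^sub>R \<alpha>" by (auto simp: span_singleton)
  then have "p = 1 \<or> p = -1"
    using assms(1) ab unfolding root_system_def by blast
  moreover have "p \<noteq> -1"
  proof
    assume "p = -1"
    then have "?r \<beta> \<delta> = - ?r \<alpha> \<delta>" for \<delta>
      using p assms(2) simple_roots_span[OF assms(2) ab(1)]
      by (simp add: representation_neg simple_roots_def)
    then have "\<forall>\<delta>\<in>\<Delta>. ?r \<alpha> \<delta> = 0"
      using * by (force simp: positive_roots_def)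
    moreover have "(\<Sum>\<delta>\<in>\<Delta>. ?r \<alpha> \<delta> *\<^sub>R \<delta>) = \<alpha>"
      using assms simple_roots_span[OF assms(2) ab(1)] finite_subset
      by (intro sum_representation_eq) (auto simp: simple_roots_def root_system_def)
    ultimately have "\<alpha> = 0" by simp
    then show False using assms(1) ab by (auto simp: root_system_def)
  qed
  ultimately show "\<alpha> = \<beta>" using p by auto
qed

section \<open>Bonds, simple roots and heights\<close>

lemma cartan_int_eq_minus_one:
  assumes "cartan_int \<alpha> \<beta> = -1" "cartan_int \<beta> \<alpha> = -1"
  shows "\<alpha> \<bullet> \<alpha> = \<beta> \<bullet> \<beta>" "2 * (\<alpha> \<bullet> \<beta>) = - (\<beta> \<bullet> \<beta>)"
  using assms by (auto simp: cartan_int_def inner_commute[of \<beta> \<alpha>] divide_eq_eq split: if_splits)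

lemma simple_root_positive:
  assumes "simple_roots \<Phi> \<Delta>" "\<alpha> \<in> \<Delta>"
  shows "\<alpha> \<in> positive_roots \<Phi> \<Delta>"
  using assms by (auto simp: simple_roots_def positive_roots_def representation_basis)

lemma ht_simple_root:
  assumes "root_system \<Phi>" "simple_roots \<Phi> \<Delta>" "\<alpha> \<in> \<Delta>"
  shows "ht \<Delta> \<alpha> = 1"
proof -
  have "finite \<Delta>"
    using assms finite_subset by (auto simp: simple_roots_def root_system_def)
  then show ?thesis
    using assms(2,3) by (simp add: ht_def simple_roots_def representation_basis)
qed

text \<open>The last hypothesis says that the Cartan integer is -1, so the sum is the reflection of
  \<alpha> in \<beta>.\<close>

lemma positive_root_add:
  assumes rs: "root_system \<Phi>" and sr: "simple_roots \<Phi> \<Delta>"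
    and pos: "\<alpha> \<in> positive_roots \<Phi> \<Delta>" "\<beta> \<in> positive_roots \<Phi> \<Delta>"
    and "2 * (\<alpha> \<bullet> \<beta>) = - (\<beta> \<bullet> \<beta>)"
  shows "\<alpha> + \<beta> \<in> positive_roots \<Phi> \<Delta>" "ht \<Delta> (\<alpha> + \<beta>) = ht \<Delta> \<alpha> + ht \<Delta> \<beta>"
proof -
  have ab: "\<alpha> \<in> \<Phi>" "\<beta> \<in> \<Phi>" using pos by (auto simp: positive_roots_def)
  then have "\<beta> \<noteq> 0" using rs by (auto simp: root_system_def)
  then have "cartan_int \<alpha> \<beta> = -1" using assms(5) by (simp add: cartan_int_def)
  then have "\<alpha> + \<beta> \<in> \<Phi>" using rs ab by (force simp: root_system_def)
  moreover have rep: "representation \<Delta> (\<alpha> + \<beta>) \<delta> = representation \<Delta> \<alpha> \<delta> + representation \<Delta> \<beta> \<delta>" for \<delta>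
    using sr simple_roots_span[OF sr] ab by (simp add: representation_add simple_roots_def)
  ultimately show "\<alpha> + \<beta> \<in> positive_roots \<Phi> \<Delta>"
    using pos by (auto simp: positive_roots_def)
  show "ht \<Delta> (\<alpha> + \<beta>) = ht \<Delta> \<alpha> + ht \<Delta> \<beta>"
    by (simp add: ht_def rep sum.distrib)
qed

section \<open>Localizations of factored and supersolvable arrangements\<close>

lemma ind_factored_pair_partition:
  "ind_factored_pair V A \<pi> \<Longrightarrow> ordered_partition A \<pi>"
  by (cases rule: ind_factored_pair.cases) (auto simp: ordered_partition_def partition_on_def)

text \<open>The hyperplanes containing \<open>X\<close> form a localization, nontrivial because of
  \<open>H\<close>. If \<open>H0\<close> does not contain \<open>X\<close>, deletion leaves the
  localization unchanged. If \<open>H0\<close> is its only member, the first block works. Otherwise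
  the restriction to \<open>H0\<close> provides the block, and bijectivity carries it back.\<close>

lemma ind_factored_pair_singleton_block:
  assumes "ind_factored_pair V A \<pi>" "H \<in> A" "X \<subseteq> H"
  shows "\<exists>B\<in>set \<pi>. card {K \<in> B. X \<subseteq> K} = 1"
  using assms
proof (induction arbitrary: H rule: ind_factored_pair.induct)
  case (empty V)
  then show ?case by simp
next
  case (step V A P Q H0 A' A'')
  have part: "\<Union> (set (P # Q)) = A" "disjoint (set (P # Q))" "distinct (P # Q)"
    using step.hyps(2) by (auto simp: ordered_partition_def partition_on_def)
  show ?case
  proof (cases "X \<subseteq> H0")
    case False
    then have "H \<in> A'" using step.prems step.hyps by auto
    then obtain B where B: "B \<in> set (P # Q)" "card {K \<in> B \<inter> A'. X \<subseteq> K} = 1"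
      using step.IH(1)[of H] step.prems unfolding set_filter set_map by blast
    have "{K \<in> B \<inter> A'. X \<subseteq> K} = {K \<in> B. X \<subseteq> K}"
      using False part B(1) step.hyps(4) by auto
    then show ?thesis using B by metis
  next
    case True
    show ?thesis
    proof (cases "{K \<in> A. X \<subseteq> K} = {H0}")
      case only: True
      then have "{K \<in> P. X \<subseteq> K} = {H0}" using part step.hyps(3) by auto
      then show ?thesis by simp
    next
      case False
      then obtain K where "K \<in> A'" "X \<subseteq> K"
        using True step.hyps(3,4) part by auto
      then have "K \<inter> H0 \<in> A''" "X \<subseteq> K \<inter> H0"
        using True step.hyps(5) by auto
      then obtain B where B: "B \<in> set Q" "card {K \<in> (\<lambda>H. H \<inter> H0) ` B. X \<subseteq> K} = 1"
        using step.IH(2)[of "K \<inter> H0"] unfolding set_map by blast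
      \<comment> \<open>Blocks other than \<open>P\<close> lie where restriction to
        \<open>H0\<close> is injective, so a single restricted hyperplane through \<open>X\<close>
        comes from a single original one.\<close>
      have "B \<subseteq> A - P"
        using part B(1) by (auto simp: disjoint_def)
      then have "inj_on (\<lambda>H. H \<inter> H0) {K \<in> B. X \<subseteq> K}"
        using step.hyps(6) by (auto simp: bij_betw_def intro: inj_on_subset)
      moreover have "{K \<in> (\<lambda>H. H \<inter> H0) ` B. X \<subseteq> K} = (\<lambda>H. H \<inter> H0) ` {K \<in> B. X \<subseteq> K}"
        using True by auto
      ultimately have "card {K \<in> B. X \<subseteq> K} = 1"
        using B(2) by (simp add: card_image)
      then show ?thesis using B(1) by auto
    qed
  qed
qed

text \<open>Blocks meeting the localization at \<open>X\<close> are at most as many as the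
  codimension of \<open>X\<close>: a restriction to \<open>H0\<close> containing \<open>X\<close>
  loses the block \<open>P\<close> and one dimension, while deletion of an \<open>H0\<close> not
  containing \<open>X\<close> changes neither number.\<close>

lemma ind_factored_pair_block_count:
  assumes "ind_factored_pair V A \<pi>" "subspace X" "X \<subseteq> V"
  shows "length (filter (\<lambda>B. \<exists>K\<in>B. X \<subseteq> K) \<pi>) + dim X \<le> dim V"
  using assms
proof (induction rule: ind_factored_pair.induct)
  case (empty V)
  then show ?case by (simp add: dim_subset)
next
  case (step V A P Q H0 A' A'')
  have part: "\<Union> (set (P # Q)) = A"
    using step.hyps(2) by (auto simp: ordered_partition_def partition_on_def)
  show ?case
  proof (cases "X \<subseteq> H0")
    case False
    \<comment> \<open>A counted block keeps its hyperplane through \<open>X\<close>, so it is not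
      among the blocks discarded as empty.\<close>
    have "filter (\<lambda>B. \<exists>K\<in>B. X \<subseteq> K) (filter (\<lambda>B. B \<noteq> {}) (map (\<lambda>B. B \<inter> A') (P # Q)))
        = map (\<lambda>B. B \<inter> A') (filter (\<lambda>B. \<exists>K\<in>B. X \<subseteq> K) (P # Q))"
      unfolding filter_filter filter_map o_def
      using False part step.hyps(4)
      by (intro arg_cong[where f = "map _"] filter_cong) auto
    then show ?thesis using step.IH(1)[OF step.prems] by (metis length_map)
  next
    case True
    have "length (filter (\<lambda>B. \<exists>K\<in>B. X \<subseteq> K) (map (\<lambda>B. (\<lambda>H. H \<inter> H0) ` B) Q))
        = length (filter (\<lambda>B. \<exists>K\<in>B. X \<subseteq> K) Q)"
      using True by (simp add: filter_map o_def)
    then have "length (filter (\<lambda>B. \<exists>K\<in>B. X \<subseteq> K) Q) + dim X \<le> dim H0"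
      using step.IH(2)[OF step.prems(1) True] by simp
    moreover have "dim H0 + 1 = dim V"
      using step.hyps(1,3) part by (auto simp: central_arrangement_def)
    ultimately show ?thesis by simp
  qed
qed

text \<open>Replaces the modular chain by the level at which it first enters each hyperplane.
  Modularity gives the first property; comparing the chain with \<open>Y\<close> gives the second.
  Only these two are used later.\<close>

lemma supersolvable_level_function:
  fixes V :: "'a::euclidean_space set"
  assumes V: "subspace V"
    and hyp: "\<And>H. H \<in> A \<Longrightarrow> \<exists>\<alpha>\<in>V. \<alpha> \<noteq> 0 \<and> H = {v \<in> V. v \<bullet> \<alpha> = 0}"
    and "supersolvable V A"
  obtains \<rho> :: "'a set \<Rightarrow> nat" where
    "\<And>H K. \<lbrakk>H \<in> A; K \<in> A; H \<noteq> K; \<rho> H = \<rho> K\<rbrakk> \<Longrightarrow> \<exists>L\<in>A. H \<inter> K \<subseteq> L \<and> \<rho> L < \<rho> H"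
    "\<And>Y. \<lbrakk>subspace Y; Y \<subseteq> V\<rbrakk> \<Longrightarrow> card (\<rho> ` {H \<in> A. Y \<subseteq> H}) + dim Y \<le> dim V"
proof -
  let ?L = "intersection_lattice V A"
  obtain X r where X0: "X 0 = V" and Xr: "X r = V \<inter> \<Inter>A"
    and dec: "\<And>i. i < r \<Longrightarrow> X (Suc i) \<subset> X i"
    and max: "subset.maxchain ?L (X ` {..r})"
    and mod: "\<And>i. i \<le> r \<Longrightarrow> modular_element V A (X i)"
    using assms(3) unfolding supersolvable_def by blast
  have anti: "X j \<subseteq> X i" if "i \<le> j" "j \<le> r" for i j
    using that
  proof (induction j rule: dec_induct)
    case (step n)
    then show ?case using dec[of n] by auto
  qed simp
  have chain: "X ` {..r} \<subseteq> ?L"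
    using max by (simp add: subset.maxchain_def subset_chain_def)
  have subH: "subspace H" "H \<subset> V" if "H \<in> A" for H
  proof -
    obtain \<alpha> where a: "\<alpha> \<in> V" "\<alpha> \<noteq> 0" and H: "H = {v \<in> V. v \<bullet> \<alpha> = 0}"
      using hyp[OF \<open>H \<in> A\<close>] by blast
    have "H = V \<inter> {v. \<alpha> \<bullet> v = 0}" using H by (auto simp: inner_commute)
    then show "subspace H"
      using V subspace_hyperplane subspace_inter by metis
    show "H \<subset> V" using a H inner_eq_zero_iff[of \<alpha>] by blast
  qed
  have subL: "subspace Z" if "Z \<in> ?L" for Z
    using that V subH(1) unfolding intersection_lattice_def
    by (auto intro!: subspace_inter subspace_Inter)
  have subX: "subspace (X i)" if "i \<le> r" for i
    using subL chain that by blast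
  \<comment> \<open>Defined because \<open>X r\<close> lies in every hyperplane, and positive
    because \<open>X 0\<close> is all of \<open>V\<close>; hence \<open>\<rho> H - 1\<close> below
    is a genuine predecessor.\<close>
  define \<rho> where "\<rho> H = (LEAST i. X i \<subseteq> H)" for H
  have \<rho>: "\<rho> H \<le> r" "X (\<rho> H) \<subseteq> H" "\<rho> H > 0" if "H \<in> A" for H
  proof -
    have "X r \<subseteq> H" using Xr that by blast
    then show "\<rho> H \<le> r" "X (\<rho> H) \<subseteq> H"
      unfolding \<rho>_def by (fact Least_le, fact LeastI)
    then show "\<rho> H > 0"
      using X0 subH(2)[OF that] by (cases "\<rho> H") auto
  qed
  have below: "\<not> X j \<subseteq> H" if "j < \<rho> H" for j H
    using not_less_Least that unfolding \<rho>_def by blast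
  \<comment> \<open>The intersection lies between two consecutive chain members, so by maximality it
    belongs to the chain; minimality of the level identifies it.\<close>
  have step: "X (\<rho> H - 1) \<inter> H = X (\<rho> H)" if H: "H \<in> A" for H
  proof -
    let ?i = "\<rho> H" and ?Z = "X (\<rho> H - 1) \<inter> H"
    have i: "?i - 1 < ?i" "?i \<le> r" "?i - 1 \<le> r" using \<rho>[OF H] by auto
    have "X (?i - 1) \<in> ?L" using chain i by blast
    then obtain B where B: "B \<subseteq> A" "X (?i - 1) = V \<inter> \<Inter>B"
      unfolding intersection_lattice_def by blast
    then have "?Z = V \<inter> \<Inter>(insert H B)" "insert H B \<subseteq> A" using H by auto
    then have ZL: "?Z \<in> ?L" unfolding intersection_lattice_def by blast
    have sub: "X ?i \<subseteq> ?Z" using anti[of "?i - 1" ?i] \<rho>[OF H] by auto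
    have comp: "?Z \<subseteq> X j \<or> X j \<subseteq> ?Z" if "j \<le> r" for j
    proof (cases "j < ?i")
      case True
      then have "X (?i - 1) \<subseteq> X j" using i by (intro anti) auto
      then show ?thesis by blast
    next
      case False
      then show ?thesis using anti[of ?i j] sub that by auto
    qed
    then have "subset.chain ?L (insert ?Z (X ` {..r}))"
      using max ZL unfolding subset.maxchain_def subset_chain_def by auto
    then have "?Z \<in> X ` {..r}"
      using max unfolding subset.maxchain_def by blast
    then obtain j where j: "j \<le> r" "?Z = X j" by blast
    have "\<not> j < ?i"
    proof
      assume "j < ?i"
      then have "X (?i - 1) \<subseteq> X j" using anti[of j "?i - 1"] i by auto
      then show False using j below[OF i(1)] by blast
    qed
    then show ?thesis using anti[of ?i j] j sub by auto
  qed
  have line: "\<exists>L\<in>A. H \<inter> K \<subseteq> L \<and> \<rho> L < \<rho> H"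
    if HK: "H \<in> A" "K \<in> A" "H \<noteq> K" "\<rho> H = \<rho> K" for H K
  proof -
    let ?W = "X (\<rho> H - 1)"
    obtain \<alpha> where a: "\<alpha> \<in> V" "\<alpha> \<noteq> 0" "H = {v \<in> V. v \<bullet> \<alpha> = 0}" using hyp HK by blast
    obtain \<beta> where b: "\<beta> \<in> V" "\<beta> \<noteq> 0" "K = {v \<in> V. v \<bullet> \<beta> = 0}" using hyp HK by blast
    have i: "\<rho> H - 1 < \<rho> H" "\<rho> H - 1 \<le> r" using \<rho>[OF HK(1)] by auto
    have W: "subspace ?W" "?W \<subseteq> V" using subX i anti[of 0] X0 by auto
    obtain w where w: "w \<in> ?W" "w \<notin> H" using below[OF i(1)] by blast
    then have wa: "w \<bullet> \<alpha> \<noteq> 0" using a W by auto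
    \<comment> \<open>Chosen so that \<delta> is orthogonal to \<open>w\<close>. Since
      \<open>?W\<close> is spanned by \<open>w\<close> and \<open>?W \<inter> H\<close>, which lies
      in \<open>K\<close> because the levels agree, \<delta> is orthogonal to all of
      \<open>?W\<close> as well as to \<open>H \<inter> K\<close>.\<close>
    define t where "t = (w \<bullet> \<beta>) / (w \<bullet> \<alpha>)"
    define \<delta> where "\<delta> = \<beta> - t *\<^sub>R \<alpha>"
    have "\<delta> \<in> V" unfolding \<delta>_def using V a b by (simp add: subspace_diff subspace_scale)
    have "\<delta> \<noteq> 0"
    proof
      assume "\<delta> = 0"
      then have eq: "\<beta> = t *\<^sub>R \<alpha>" by (simp add: \<delta>_def)
      then have "t \<noteq> 0" using b by auto
      then have "H = K" using a b by (auto simp: eq)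
      then show False using HK by simp
    qed
    have Wd: "v \<bullet> \<delta> = 0" if "v \<in> ?W" for v
    proof -
      let ?v = "v - ((v \<bullet> \<alpha>) / (w \<bullet> \<alpha>)) *\<^sub>R w"
      have "?v \<in> ?W" using W w that by (simp add: subspace_diff subspace_scale)
      moreover have "?v \<bullet> \<alpha> = 0" using wa by (simp add: inner_diff_left)
      ultimately have "?v \<in> ?W \<inter> H" using a W by auto
      then have "?v \<in> K" using step[OF HK(1)] step[OF HK(2)] HK(4) by auto
      then have "?v \<bullet> \<beta> = 0" using b by auto
      then show ?thesis using wa by (simp add: \<delta>_def t_def inner_diff_left inner_diff_right field_simps)
    qed
    have HKd: "v \<bullet> \<delta> = 0" if "v \<in> H \<inter> K" for v
      using that a b by (simp add: \<delta>_def inner_diff_right)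
    have "H \<inter> K = V \<inter> \<Inter>{H, K}" using subH(2)[OF HK(1)] by auto
    then have "H \<inter> K \<in> ?L" using HK unfolding intersection_lattice_def by blast
    \<comment> \<open>Modularity makes the sum a flat. It misses \<delta>, so it is not
      \<open>V\<close> and lies in some hyperplane \<open>L\<close> of the arrangement; containing
      \<open>?W\<close>, this \<open>L\<close> has a lower level.\<close>
    then have "?W + (H \<inter> K) \<in> ?L"
      using mod[OF i(2)] unfolding modular_element_def by blast
    then obtain B where B: "B \<subseteq> A" "?W + (H \<inter> K) = V \<inter> \<Inter>B"
      unfolding intersection_lattice_def by blast
    have "\<delta> \<notin> ?W + (H \<inter> K)"
    proof
      assume "\<delta> \<in> ?W + (H \<inter> K)"
      then obtain x y where "\<delta> = x + y" "x \<in> ?W" "y \<in> H \<inter> K" unfolding set_plus_def by blast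
      then have "\<delta> \<bullet> \<delta> = 0" using Wd[of x] HKd[of y] by (metis inner_add_left add_0)
      then show False using \<open>\<delta> \<noteq> 0\<close> by simp
    qed
    then obtain L where L: "L \<in> B" using B \<open>\<delta> \<in> V\<close> by blast
    have sumL: "x + y \<in> L" if "x \<in> ?W" "y \<in> H \<inter> K" for x y
      using set_plus_intro[OF that] B L by blast
    have z: "0 \<in> ?W" "0 \<in> H \<inter> K"
      using W subH(1)[OF HK(1)] subH(1)[OF HK(2)] by (auto simp: subspace_0)
    have "?W \<subseteq> L" "H \<inter> K \<subseteq> L"
      using sumL[OF _ z(2)] sumL[OF z(1)] by auto
    moreover have "\<rho> L \<le> \<rho> H - 1"
      unfolding \<rho>_def[of L] using \<open>?W \<subseteq> L\<close> by (rule Least_le)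
    ultimately show ?thesis using L B i by (metis le_less_trans subsetD)
  qed
  have count: "card (\<rho> ` {H \<in> A. Y \<subseteq> H}) + dim Y \<le> dim V" if Y: "subspace Y" "Y \<subseteq> V" for Y
  proof -
    let ?T = "\<rho> ` {H \<in> A. Y \<subseteq> H}"
    \<comment> \<open>Separates the levels at \<open>Y\<close>: for \<open>K\<close> through
      \<open>Y\<close>, the sum lies in \<open>K\<close> at the level of \<open>K\<close> but at no
      earlier index. So the dimension drops strictly from level to level, staying at least
      \<open>dim Y\<close> and below \<open>dim V\<close>.\<close>
    define f where "f i = dim (X i + Y)" for i
    have sub: "subspace (X i + Y)" if "i \<le> r" for i
    proof -
      have "X i + Y = {x + y |x y. x \<in> X i \<and> y \<in> Y}" by (auto simp: set_plus_def)
      then show ?thesis using subspace_sums[OF subX[OF that] Y(1)] by simp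
    qed
    have inH: "X (\<rho> H) + Y \<subseteq> H" if "H \<in> A" "Y \<subseteq> H" for H
    proof
      fix v assume "v \<in> X (\<rho> H) + Y"
      then obtain x y where "v = x + y" "x \<in> X (\<rho> H)" "y \<in> Y" unfolding set_plus_def by blast
      then show "v \<in> H" using \<rho>(2)[OF that(1)] that(2) subH(1)[OF that(1)]
        by (metis subsetD subspace_add)
    qed
    have less: "f (\<rho> K) < f (\<rho> H)" if HK: "H \<in> A" "K \<in> A" "Y \<subseteq> K" "\<rho> H < \<rho> K" for H K
    proof -
      have "X (\<rho> K) + Y \<subseteq> X (\<rho> H) + Y"
        using anti[of "\<rho> H" "\<rho> K"] \<rho>[OF HK(2)] HK by (intro set_plus_mono2) auto
      moreover have "X (\<rho> H) \<subseteq> X (\<rho> H) + Y"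
        using Y(1) by (metis add.right_neutral set_plus_intro subsetI subspace_0)
      then have "\<not> X (\<rho> H) + Y \<subseteq> K"
        using below[OF HK(4)] by blast
      ultimately have "X (\<rho> K) + Y \<subset> X (\<rho> H) + Y"
        using inH[OF HK(2,3)] by blast
      then have "span (X (\<rho> K) + Y) \<subset> span (X (\<rho> H) + Y)"
        using sub \<rho>(1) HK(1,2) by (metis span_eq_iff)
      then show ?thesis unfolding f_def by (rule dim_psubset)
    qed
    have "inj_on f ?T"
    proof (rule inj_onI)
      fix i j assume *: "i \<in> ?T" "j \<in> ?T" "f i = f j"
      then obtain H K where "H \<in> A" "Y \<subseteq> H" "i = \<rho> H" "K \<in> A" "Y \<subseteq> K" "j = \<rho> K" by blast
      then show "i = j" using less[of H K] less[of K H] *(3) by (metis less_irrefl nat_neq_iff)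
    qed
    moreover have "f ` ?T \<subseteq> {dim Y..<dim V}"
    proof
      fix k assume "k \<in> f ` ?T"
      then obtain H where H: "H \<in> A" "Y \<subseteq> H" "k = f (\<rho> H)" by blast
      have "Y \<subseteq> X (\<rho> H) + Y"
        using subX[OF \<rho>(1)[OF H(1)]] by (metis add_0 set_plus_intro subsetI subspace_0)
      then have "dim Y \<le> k" unfolding H(3) f_def by (rule dim_subset)
      moreover have "k \<le> dim H" unfolding H(3) f_def using inH[OF H(1,2)] by (rule dim_subset)
      moreover have "dim H < dim V"
        using subH[OF H(1)] V by (intro dim_psubset) (metis span_eq_iff)
      ultimately show "k \<in> {dim Y..<dim V}" by simp
    qed
    ultimately have "card ?T \<le> dim V - dim Y"
      using card_inj_on_le[of f ?T "{dim Y..<dim V}"] by simp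
    then show ?thesis using dim_subset[OF Y(2)] by simp
  qed
  show thesis
    by (rule that) (fact line, fact count)
qed

section \<open>The star \<open>D\<^sub>4\<close>\<close>

text \<open>The centre of the star is \<open>c\<close>. Further simple roots may exist; the common
  squared length \<open>N\<close> is a parameter because root systems are not normalized.\<close>

locale D4_subdiagram =
  fixes \<Phi> \<Delta> :: "'a::euclidean_space set" and a b c d :: 'a and N :: real
  assumes rs: "root_system \<Phi>" and sr: "simple_roots \<Phi> \<Delta>"
    and simple: "a \<in> \<Delta>" "b \<in> \<Delta>" "c \<in> \<Delta>" "d \<in> \<Delta>"
    and norm: "a \<bullet> a = N" "b \<bullet> b = N" "c \<bullet> c = N" "d \<bullet> d = N"
    and edge: "a \<bullet> c = - N / 2" "b \<bullet> c = - N / 2" "d \<bullet> c = - N / 2"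
    and nonedge: "a \<bullet> b = 0" "a \<bullet> d = 0" "b \<bullet> d = 0"
begin

abbreviation "P \<equiv> positive_roots \<Phi> \<Delta>"
abbreviation "H \<equiv> root_hyperplane \<Phi>"
abbreviation "\<Gamma> \<equiv> {a, b, c, d}"

definition "Y = {v \<in> span \<Phi>. \<forall>\<gamma>\<in>\<Gamma>. v \<bullet> \<gamma> = 0}"

text \<open>The missing fourth member of this frame is the highest root
  \<open>a + b + 2c + d\<close> of the star, of height 5. The heights in \<open>F2\<close> are 2, 2,
  2, 4 and those in \<open>F3\<close> are 1, 3, 3, 3.\<close>

definition "F1 = {a, b, d}"
definition "F2 = {a + c, b + c, d + c, a + b + c + d}"
definition "F3 = {c, a + b + c, a + c + d, b + c + d}"

lemmas frame_defs = F1_def F2_def F3_def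

lemma gram:
  "a \<bullet> a = N" "b \<bullet> b = N" "c \<bullet> c = N" "d \<bullet> d = N"
  "a \<bullet> c = - N / 2" "b \<bullet> c = - N / 2" "d \<bullet> c = - N / 2"
  "c \<bullet> a = - N / 2" "c \<bullet> b = - N / 2" "c \<bullet> d = - N / 2"
  "a \<bullet> b = 0" "a \<bullet> d = 0" "b \<bullet> d = 0" "b \<bullet> a = 0" "d \<bullet> a = 0" "d \<bullet> b = 0"
  using norm edge nonedge by (auto simp: inner_commute)

lemma N_pos: "N > 0"
proof -
  have "a \<noteq> 0" using rs sr simple(1) by (auto simp: root_system_def simple_roots_def)
  then show ?thesis using norm(1) inner_gt_zero_iff[of a] by simp
qed

lemma frames_span: "F1 \<union> F2 \<union> F3 \<subseteq> span \<Gamma>"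
  unfolding frame_defs by (auto intro!: span_add intro: span_base)

lemma frames_norm: "\<alpha> \<in> F1 \<union> F2 \<union> F3 \<Longrightarrow> \<alpha> \<bullet> \<alpha> = N"
  by (auto simp: frame_defs inner_add_left inner_add_right gram)

lemma frames_orthogonal:
  "\<lbrakk>\<alpha> \<in> F1; \<beta> \<in> F1; \<alpha> \<noteq> \<beta>\<rbrakk> \<Longrightarrow> \<alpha> \<bullet> \<beta> = 0"
  "\<lbrakk>\<alpha> \<in> F2; \<beta> \<in> F2; \<alpha> \<noteq> \<beta>\<rbrakk> \<Longrightarrow> \<alpha> \<bullet> \<beta> = 0"
  "\<lbrakk>\<alpha> \<in> F3; \<beta> \<in> F3; \<alpha> \<noteq> \<beta>\<rbrakk> \<Longrightarrow> \<alpha> \<bullet> \<beta> = 0"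
  unfolding frame_defs by (elim insertE emptyE; simp add: inner_add_left inner_add_right gram)+

text \<open>A common root would have inner product \<open>N\<close> with itself, a value never taken
  between these frames.\<close>

lemma frames_disjoint: "F1 \<inter> F3 = {}" "F2 \<inter> F3 = {}"
proof -
  have "\<alpha> \<bullet> \<beta> \<noteq> N" if "\<alpha> \<in> F1 \<union> F2" "\<beta> \<in> F3" for \<alpha> \<beta>
    using that N_pos unfolding frame_defs
    by (elim UnE insertE emptyE; simp add: inner_add_left inner_add_right gram)
  then show "F1 \<inter> F3 = {}" "F2 \<inter> F3 = {}"
    using frames_norm by blast+
qed

lemma frames_card: "card F1 = 3" "card F2 = 4" "card F3 = 4"
proof -
  have ne: "\<alpha> \<noteq> \<beta>" if "\<alpha> \<bullet> \<beta> = 0" "\<alpha> \<bullet> \<alpha> = N" for \<alpha> \<beta> :: 'a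
    using that N_pos by auto
  have "distinct [a, b, d]" "distinct [a + c, b + c, d + c, a + b + c + d]"
    "distinct [c, a + b + c, a + c + d, b + c + d]"
    unfolding distinct.simps list.set insert_iff empty_iff de_Morgan_disj not_False_eq_True
    by ((intro conjI ne TrueI; simp only: inner_add_left inner_add_right gram; simp)+)
  from this[THEN distinct_card] show "card F1 = 3" "card F2 = 4" "card F3 = 4"
    by (simp_all add: frame_defs)
qed

text \<open>The nonsimple roots arise by adding one simple root at a time. The height bounds are
  what keeps \<open>F1 \<union> F3\<close> out of ideals starting at height 4, and
  \<open>F2 \<union> F3\<close> out of those starting at height 5.\<close>

lemma frames_positive:
  "F1 \<union> F2 \<union> F3 \<subseteq> P" "\<alpha> \<in> F1 \<union> F3 \<Longrightarrow> ht \<Delta> \<alpha> < 4" "\<alpha> \<in> F2 \<union> F3 \<Longrightarrow> ht \<Delta> \<alpha> < 5"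
proof -
  note add = positive_root_add[OF rs sr]
  note s = simple[THEN simple_root_positive[OF sr]]
  have h: "ht \<Delta> a = 1" "ht \<Delta> b = 1" "ht \<Delta> c = 1" "ht \<Delta> d = 1"
    using simple ht_simple_root[OF rs sr] by auto
  have 1: "a + c \<in> P" "ht \<Delta> (a + c) = 2" using add[of a c] s h by (auto simp: gram)
  have 2: "b + c \<in> P" "ht \<Delta> (b + c) = 2" using add[of b c] s h by (auto simp: gram)
  have 3: "d + c \<in> P" "ht \<Delta> (d + c) = 2" using add[of d c] s h by (auto simp: gram)
  have 4: "a + b + c \<in> P" "ht \<Delta> (a + b + c) = 3"
    using add[of "a + c" b] 1 s h by (auto simp: gram inner_add_left add_ac)
  have 5: "a + c + d \<in> P" "ht \<Delta> (a + c + d) = 3"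
    using add[of "a + c" d] 1 s h by (auto simp: gram inner_add_left add_ac)
  have 6: "b + c + d \<in> P" "ht \<Delta> (b + c + d) = 3"
    using add[of "b + c" d] 2 s h by (auto simp: gram inner_add_left add_ac)
  have 7: "a + b + c + d \<in> P" "ht \<Delta> (a + b + c + d) = 4"
    using add[of "a + b + c" d] 4 s h by (auto simp: gram inner_add_left)
  show "F1 \<union> F2 \<union> F3 \<subseteq> P" using s 1 2 3 4 5 6 7 by (auto simp: frame_defs)
  show "\<alpha> \<in> F1 \<union> F3 \<Longrightarrow> ht \<Delta> \<alpha> < 4" using h 4 5 6 by (auto simp: frame_defs)
  show "\<alpha> \<in> F2 \<union> F3 \<Longrightarrow> ht \<Delta> \<alpha> < 5" using h 1 2 3 4 5 6 7 by (auto simp: frame_defs)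
qed

lemma Y_subspace: "subspace Y" "Y \<subseteq> span \<Phi>" "dim (span \<Phi>) \<le> dim Y + 4"
proof -
  have sub: "\<Gamma> \<subseteq> span \<Phi>"
    using simple sr span_base by (auto simp: simple_roots_def)
  show "subspace Y"
    by (auto simp: Y_def subspace_def inner_add_left span_zero span_add span_scale)
  show "Y \<subseteq> span \<Phi>" by (auto simp: Y_def)
  have "card \<Gamma> \<le> 4" using card_length[of "[a, b, c, d]"] by simp
  then show "dim (span \<Phi>) \<le> dim Y + 4"
    using dim_orthogonal_finite[OF subspace_span _ sub] by (simp add: Y_def)
qed

lemma Y_subset_hyperplane:
  assumes "\<alpha> \<in> span \<Gamma>" shows "Y \<subseteq> H \<alpha>"
proof
  fix v assume v: "v \<in> Y"
  then have "orthogonal v \<gamma>" if "\<gamma> \<in> \<Gamma>" for \<gamma>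
    using that by (auto simp: Y_def orthogonal_def)
  then have "orthogonal v \<alpha>" using orthogonal_to_span[OF assms, of v] by blast
  then show "v \<in> H \<alpha>" using v by (simp add: Y_def root_hyperplane_def orthogonal_def)
qed

lemma in_span_pair:
  assumes "\<alpha> \<in> P" "\<beta> \<in> P" "\<gamma> \<in> P" "H \<alpha> \<inter> H \<beta> \<subseteq> H \<gamma>"
  shows "\<gamma> \<in> span {\<alpha>, \<beta>}"
proof (rule in_span_if_hyperplanes)
  show "subspace (span \<Phi>)" "{\<alpha>, \<beta>} \<subseteq> span \<Phi>" "\<gamma> \<in> span \<Phi>"
    using assms(1-3) span_base by (auto simp: positive_roots_def)
  show "v \<bullet> \<gamma> = 0" if "v \<in> span \<Phi>" "\<And>\<delta>. \<delta> \<in> {\<alpha>, \<beta>} \<Longrightarrow> v \<bullet> \<delta> = 0" for v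
    using assms(4) that by (auto simp: root_hyperplane_def)
qed

lemma hyperplane_eq: "\<lbrakk>\<alpha> \<in> P; \<beta> \<in> P; H \<alpha> = H \<beta>\<rbrakk> \<Longrightarrow> \<alpha> = \<beta>"
  using inj_on_root_hyperplane[OF rs sr] by (auto dest: inj_onD)

text \<open>Every root in the span of the star has squared length \<open>N\<close>, so the plane of
  an orthogonal pair contains only these roots and their negatives; positivity removes the
  negatives.\<close>

lemma orthogonal_span:
  assumes "\<alpha> \<in> F1 \<union> F2 \<union> F3" "\<beta> \<in> F1 \<union> F2 \<union> F3" "\<alpha> \<bullet> \<beta> = 0" "\<gamma> \<in> P" "\<gamma> \<in> span {\<alpha>, \<beta>}"
  shows "\<gamma> = \<alpha> \<or> \<gamma> = \<beta>"
proof -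
  have pos: "\<alpha> \<in> P" "\<beta> \<in> P" using assms(1,2) frames_positive(1) by blast+
  have "span {\<alpha>, \<beta>} \<subseteq> span \<Gamma>"
    using assms(1,2) frames_span by (intro span_minimal) (auto simp: subspace_span)
  then have sp: "\<gamma> \<in> span \<Gamma>" using assms(5) by blast
  have sub: "\<Gamma> \<subseteq> \<Delta>" using simple by simp
  have len: "\<delta> \<bullet> \<delta> = N" if "\<delta> \<in> \<Gamma>" for \<delta> using that norm by auto
  have "\<gamma> \<in> \<Phi>" using assms(4) by (simp add: positive_roots_def)
  then have "\<gamma> \<bullet> \<gamma> = N" using root_inner_self[OF rs sr sub len _ sp] by blast
  moreover have "\<alpha> \<in> \<Phi>" "\<beta> \<in> \<Phi>" "\<gamma> \<in> \<Phi>"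
    using pos assms(4) by (simp_all add: positive_roots_def)
  ultimately have "\<gamma> \<in> {\<alpha>, - \<alpha>, \<beta>, - \<beta>}"
    using orthogonal_roots_span[OF rs _ _ _ assms(3) frames_norm[OF assms(1)] frames_norm[OF assms(2)]]
      assms(5) by blast
  moreover have "H (- \<delta>) = H \<delta>" for \<delta> by (simp add: root_hyperplane_def)
  ultimately have "H \<gamma> = H \<alpha> \<or> H \<gamma> = H \<beta>" by auto
  then show ?thesis using hyperplane_eq pos assms(4) by blast
qed

text \<open>At most four levels occur at \<open>Y\<close>, and \<open>F3\<close> represents each
  once. The bottom level holds a single root, so the three roots of \<open>F1\<close> fill the other
  levels, and \<open>F1\<close> and \<open>F3\<close> meet on the second one.\<close>

lemma not_supersolvable:
  assumes S: "S \<subseteq> P" "F1 \<union> F3 \<subseteq> S"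
  shows "\<not> supersolvable (span \<Phi>) (H ` S)"
proof
  assume ss: "supersolvable (span \<Phi>) (H ` S)"
  have "\<exists>\<alpha>\<in>span \<Phi>. \<alpha> \<noteq> 0 \<and> K = {v \<in> span \<Phi>. v \<bullet> \<alpha> = 0}" if "K \<in> H ` S" for K
  proof -
    obtain \<alpha> where "\<alpha> \<in> S" "K = H \<alpha>" using \<open>K \<in> H ` S\<close> by blast
    moreover from this have "\<alpha> \<in> \<Phi>" using S by (auto simp: positive_roots_def)
    moreover from this have "\<alpha> \<noteq> 0" using rs by (auto simp: root_system_def)
    ultimately show ?thesis
      using span_base by (intro bexI[of _ \<alpha>]) (auto simp: root_hyperplane_def)
  qed
  then obtain \<rho> :: "'a set \<Rightarrow> nat" where
    line: "\<And>K L. \<lbrakk>K \<in> H ` S; L \<in> H ` S; K \<noteq> L; \<rho> K = \<rho> L\<rbrakk> \<Longrightarrow> \<exists>M\<in>H ` S. K \<inter> L \<subseteq> M \<and> \<rho> M < \<rho> K"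
    and count: "\<And>Y. \<lbrakk>subspace Y; Y \<subseteq> span \<Phi>\<rbrakk> \<Longrightarrow>
      card (\<rho> ` {K \<in> H ` S. Y \<subseteq> K}) + dim Y \<le> dim (span \<Phi>)"
    using supersolvable_level_function[OF subspace_span _ ss] by blast
  define r where "r \<alpha> = \<rho> (H \<alpha>)" for \<alpha>
  define R where "R = {\<alpha> \<in> S. Y \<subseteq> H \<alpha>}"
  have coll: "\<exists>\<gamma>\<in>R. H \<alpha> \<inter> H \<beta> \<subseteq> H \<gamma> \<and> r \<gamma> < r \<alpha>"
    if ab: "\<alpha> \<in> R" "\<beta> \<in> R" "\<alpha> \<noteq> \<beta>" "r \<alpha> = r \<beta>" for \<alpha> \<beta>
  proof -
    have "H \<alpha> \<noteq> H \<beta>" using ab hyperplane_eq S by (auto simp: R_def)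
    then obtain M where "M \<in> H ` S" "H \<alpha> \<inter> H \<beta> \<subseteq> M" "\<rho> M < \<rho> (H \<alpha>)"
      using line[of "H \<alpha>" "H \<beta>"] ab unfolding R_def r_def by blast
    moreover from this obtain \<gamma> where "\<gamma> \<in> S" "M = H \<gamma>" by blast
    moreover have "Y \<subseteq> H \<alpha> \<inter> H \<beta>" using ab by (auto simp: R_def)
    ultimately show ?thesis unfolding R_def r_def by blast
  qed
  have FR: "F1 \<union> F3 \<subseteq> R"
    using S frames_span Y_subset_hyperplane unfolding R_def by blast
  have RP: "R \<subseteq> P" using S by (auto simp: R_def)
  \<comment> \<open>Distinct orthogonal roots on one level would need a third root, of lower level,
    in their plane.\<close>
  have inj: "\<alpha> = \<beta>" if ab: "\<alpha> \<in> F1 \<union> F3" "\<beta> \<in> F1 \<union> F3" "\<alpha> \<bullet> \<beta> = 0 \<or> \<alpha> = \<beta>" "r \<alpha> = r \<beta>" for \<alpha> \<beta>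
  proof (rule ccontr)
    assume "\<alpha> \<noteq> \<beta>"
    then obtain \<gamma> where g: "\<gamma> \<in> R" "H \<alpha> \<inter> H \<beta> \<subseteq> H \<gamma>" "r \<gamma> < r \<alpha>"
      using coll[of \<alpha> \<beta>] ab FR by blast
    have "\<gamma> \<in> span {\<alpha>, \<beta>}"
      using ab g FR RP by (intro in_span_pair) blast+
    then have "\<gamma> = \<alpha> \<or> \<gamma> = \<beta>"
      using orthogonal_span[of \<alpha> \<beta> \<gamma>] ab g RP \<open>\<alpha> \<noteq> \<beta>\<close> by blast
    then show False using g ab by auto
  qed
  have inj1: "inj_on r F1" and inj3: "inj_on r F3"
    using inj frames_orthogonal(1,3) by (meson UnI1 UnI2 inj_onI)+
  have "r ` R = \<rho> ` {K \<in> H ` S. Y \<subseteq> K}"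
    by (auto simp: r_def R_def)
  then have "card (r ` R) \<le> 4"
    using count[OF Y_subspace(1,2)] Y_subspace(3) by simp
  moreover have finR: "finite (r ` R)"
    using rs S by (auto simp: R_def root_system_def positive_roots_def intro: finite_subset)
  moreover have "r ` F3 \<subseteq> r ` R" using FR by blast
  moreover have "card (r ` F3) = 4" using inj3 frames_card by (simp only: card_image)
  ultimately have T: "r ` F3 = r ` R" by (metis card_seteq)
  define m where "m = Min (r ` R)"
  have min: "m \<le> r \<alpha>" if "\<alpha> \<in> R" for \<alpha> using that finR by (simp add: m_def)
  have "r ` R \<noteq> {}" using T \<open>card (r ` F3) = 4\<close> by auto
  then have "m \<in> r ` R" unfolding m_def using Min_in[OF finR] by simp
  then have "m \<in> r ` F3" by (simp only: T)
  then obtain w where w: "w \<in> F3" "r w = m" by auto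
  \<comment> \<open>Two roots on the lowest level would produce one on a still lower level.\<close>
  have uniq: "\<alpha> = w" if "\<alpha> \<in> R" "r \<alpha> = m" for \<alpha>
  proof (rule ccontr)
    assume "\<alpha> \<noteq> w"
    moreover have "w \<in> R" using w FR by auto
    ultimately obtain \<gamma> where "\<gamma> \<in> R" "r \<gamma> < r \<alpha>"
      using coll[OF \<open>\<alpha> \<in> R\<close>] w \<open>r \<alpha> = m\<close> by metis
    then show False using min[of \<gamma>] \<open>r \<alpha> = m\<close> by simp
  qed
  let ?T = "r ` R - {m}"
  have "r ` F1 \<subseteq> ?T"
  proof
    fix i assume "i \<in> r ` F1"
    then obtain \<alpha> where "\<alpha> \<in> F1" "i = r \<alpha>" by auto
    moreover from this have "\<alpha> \<in> R" "\<alpha> \<noteq> w" using FR w frames_disjoint(1) by auto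
    ultimately show "i \<in> ?T" using uniq[of \<alpha>] by auto
  qed
  moreover have "card (r ` F1) = 3" using inj1 frames_card by (simp only: card_image)
  moreover have "card ?T = 3"
    using T \<open>card (r ` F3) = 4\<close> \<open>m \<in> r ` R\<close> finR by simp
  ultimately have T1: "r ` F1 = ?T" using finR by (metis card_subset_eq finite_Diff)
  define m' where "m' = Min ?T"
  have "m' \<in> ?T" unfolding m'_def using finR \<open>card ?T = 3\<close>
    by (metis Min_in card.empty finite_Diff zero_neq_numeral)
  then obtain x z where x: "x \<in> F1" "r x = m'" and z: "z \<in> F3" "r z = m'"
    using T T1 by (metis DiffD1 imageE)
  have "x \<noteq> z" using x z frames_disjoint(1) by blast
  then obtain \<gamma> where g: "\<gamma> \<in> R" "H x \<inter> H z \<subseteq> H \<gamma>" "r \<gamma> < m'"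
    using coll[of x z] x z FR by (metis UnI1 UnI2 subsetD)
  \<comment> \<open>Only the bottom level lies below \<open>m'\<close>, so the third root is
    \<open>w\<close>.\<close>
  have "r \<gamma> \<notin> ?T" using g finR unfolding m'_def by (meson Min_le finite_Diff not_le)
  then have "\<gamma> = w" using uniq g by blast
  then have "w \<in> span {x, z}"
    using g x z FR RP by (intro in_span_pair) blast+
  have "z \<noteq> w" using z w \<open>m' \<in> ?T\<close> by auto
  then have wz: "w \<bullet> z = 0" using frames_orthogonal(3) z w by metis
  have "w \<notin> span {z}"
  proof
    assume "w \<in> span {z}"
    then obtain k where "w = k *\<^sub>R z" by (auto simp: span_singleton)
    then have "w \<bullet> w = 0" using wz by simp
    then show False using frames_norm[of w] w N_pos by simp
  qed
  \<comment> \<open>Exchange: the plane of \<open>x\<close> and \<open>z\<close> is also spanned by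
    \<open>w\<close> and \<open>z\<close>, which are orthogonal as members of \<open>F3\<close>, so
    it has no room for \<open>x\<close>.\<close>
  then have "x \<in> span {w, z}"
    using \<open>w \<in> span {x, z}\<close> in_span_insert[of w x "{z}"] by blast
  then have "x = w \<or> x = z"
    using orthogonal_span[of w z x] wz w z x FR RP by blast
  then show False using x w z frames_disjoint(1) by blast
qed

text \<open>At most four blocks meet the localization at \<open>Y\<close>. Each complete frame hits
  all of them, so none of them meets the localization in a singleton.\<close>

lemma not_inductively_factored:
  assumes S: "S \<subseteq> P" "F2 \<union> F3 \<subseteq> S"
  shows "\<not> inductively_factored (span \<Phi>) (H ` S)"
proof
  assume "inductively_factored (span \<Phi>) (H ` S)"
  then obtain \<pi> where \<pi>: "ind_factored_pair (span \<Phi>) (H ` S) \<pi>"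
    by (auto simp: inductively_factored_def)
  have part: "partition_on (H ` S) (set \<pi>)"
    using ind_factored_pair_partition[OF \<pi>] by (simp add: ordered_partition_def)
  define T where "T = set (filter (\<lambda>B. \<exists>K\<in>B. Y \<subseteq> K) \<pi>)"
  have "card T + dim Y \<le> dim (span \<Phi>)"
    unfolding T_def using ind_factored_pair_block_count[OF \<pi> Y_subspace(1,2)] card_length
    by (meson add_le_mono1 le_trans)
  then have B4: "card T \<le> 4" using Y_subspace(3) by simp
  have sep: "\<alpha> = \<beta>" if ab: "\<alpha> \<in> F2 \<union> F3" "\<beta> \<in> F2 \<union> F3" "\<alpha> \<bullet> \<beta> = 0 \<or> \<alpha> = \<beta>"
    and B: "B \<in> set \<pi>" "H \<alpha> \<in> B" "H \<beta> \<in> B" for \<alpha> \<beta> B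
  proof (rule ccontr)
    assume ne: "\<alpha> \<noteq> \<beta>"
    let ?X = "H \<alpha> \<inter> H \<beta>"
    have abP: "\<alpha> \<in> P" "\<beta> \<in> P" "H \<alpha> \<in> H ` S" using ab S by blast+
    have two: "K = H \<alpha> \<or> K = H \<beta>" if K: "K \<in> H ` S" "?X \<subseteq> K" for K
    proof -
      obtain \<gamma> where "\<gamma> \<in> S" "K = H \<gamma>" using K by blast
      moreover from this have "\<gamma> \<in> span {\<alpha>, \<beta>}"
        using K S abP by (intro in_span_pair) blast+
      ultimately show ?thesis
        using orthogonal_span[of \<alpha> \<beta> \<gamma>] ab ne S by blast
    qed
    \<comment> \<open>The localization at \<open>?X\<close> consists of the two given hyperplanes
      only. Its singleton block shares one of them with \<open>B\<close>, hence equals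
      \<open>B\<close>, which contains both.\<close>
    obtain C where C: "C \<in> set \<pi>" "card {K \<in> C. ?X \<subseteq> K} = 1"
      using ind_factored_pair_singleton_block[OF \<pi> abP(3), of ?X] by blast
    then obtain K where K: "{K \<in> C. ?X \<subseteq> K} = {K}" by (auto simp: card_1_singleton_iff)
    then have "K \<in> C" "?X \<subseteq> K" by blast+
    then have "K = H \<alpha> \<or> K = H \<beta>"
      using two part C(1) unfolding partition_on_def by blast
    then have "K \<in> C \<inter> B" using B \<open>K \<in> C\<close> by blast
    then have "C = B"
      using disjointD[OF partition_onD2[OF part] C(1) B(1)] by blast
    then have "H \<alpha> = H \<beta>" using K B by blast
    then show False using hyperplane_eq abP ne by blast
  qed
  \<comment> \<open>Four pairwise orthogonal roots occupy four distinct blocks of \<open>T\<close>,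
    and \<open>T\<close> has no more.\<close>
  have meet: "\<exists>\<alpha>\<in>F. H \<alpha> \<in> B"
    if B: "B \<in> T" and F: "F \<subseteq> F2 \<union> F3" "card F = 4" "\<And>\<alpha> \<beta>. \<lbrakk>\<alpha> \<in> F; \<beta> \<in> F; \<alpha> \<noteq> \<beta>\<rbrakk> \<Longrightarrow> \<alpha> \<bullet> \<beta> = 0"
    for B F
  proof -
    have "\<exists>B\<in>T. H \<alpha> \<in> B" if "\<alpha> \<in> F" for \<alpha>
    proof -
      have "\<alpha> \<in> F2 \<union> F3" using that F(1) by blast
      then have "H \<alpha> \<in> H ` S" "\<alpha> \<in> span \<Gamma>" using S(2) frames_span by blast+
      then have "H \<alpha> \<in> \<Union> (set \<pi>)" "Y \<subseteq> H \<alpha>"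
        using partition_onD1[OF part] Y_subset_hyperplane by simp_all
      then show ?thesis by (auto simp: T_def)
    qed
    then have "\<forall>\<alpha>\<in>F. \<exists>B. B \<in> T \<and> H \<alpha> \<in> B" by blast
    from bchoice[OF this] obtain g where g: "\<And>\<alpha>. \<alpha> \<in> F \<Longrightarrow> g \<alpha> \<in> T \<and> H \<alpha> \<in> g \<alpha>" by blast
    have "inj_on g F"
    proof (rule inj_onI)
      fix \<alpha> \<beta> assume *: "\<alpha> \<in> F" "\<beta> \<in> F" "g \<alpha> = g \<beta>"
      have "g \<alpha> \<in> set \<pi>" "H \<alpha> \<in> g \<alpha>" "H \<beta> \<in> g \<alpha>" using g[OF *(1)] g[OF *(2)] *(3) by (auto simp: T_def)
      then show "\<alpha> = \<beta>" using sep[of \<alpha> \<beta> "g \<alpha>"] F(1,3) *(1,2) by blast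
    qed
    then have "card (g ` F) = 4" using F(2) by (simp add: card_image)
    moreover have "g ` F \<subseteq> T" using g by blast
    ultimately have "g ` F = T"
      using B4 by (intro card_seteq) (auto simp: T_def)
    then show ?thesis using B g by blast
  qed
  \<comment> \<open>The root \<open>c\<close> serves only to show that the localization at
    \<open>Y\<close> is nontrivial.\<close>
  have "c \<in> F3" by (simp add: F3_def)
  then have "H c \<in> H ` S" using S(2) by blast
  moreover have "Y \<subseteq> H c" by (intro Y_subset_hyperplane span_base) simp
  ultimately obtain B where B: "B \<in> set \<pi>" "card {K \<in> B. Y \<subseteq> K} = 1"
    using ind_factored_pair_singleton_block[OF \<pi>] by blast
  then obtain K where K: "{K \<in> B. Y \<subseteq> K} = {K}" by (auto simp: card_1_singleton_iff)
  then have "B \<in> T" using B(1) by (auto simp: T_def)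
  then obtain \<alpha> \<beta> where ab: "\<alpha> \<in> F2" "H \<alpha> \<in> B" "\<beta> \<in> F3" "H \<beta> \<in> B"
    using meet[of B F2] meet[of B F3] frames_card frames_orthogonal by blast
  then have "\<alpha> \<in> span \<Gamma>" "\<beta> \<in> span \<Gamma>" using frames_span by blast+
  then have "Y \<subseteq> H \<alpha>" "Y \<subseteq> H \<beta>" by (simp_all only: Y_subset_hyperplane)
  then have "H \<alpha> \<in> {K \<in> B. Y \<subseteq> K}" "H \<beta> \<in> {K \<in> B. Y \<subseteq> K}" using ab by simp_all
  then have "H \<alpha> = H \<beta>" unfolding K by simp
  moreover have "\<alpha> \<in> P" "\<beta> \<in> P" using ab frames_positive(1) by blast+
  ultimately have "\<alpha> = \<beta>" using hyperplane_eq by blast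
  then show False using ab frames_disjoint(2) by blast
qed

end

section \<open>Finding the star in the diagrams of types D and E, and the conclusion\<close>

lemma D4_subdiagram_of_star:
  assumes rs: "root_system \<Phi>" and sr: "simple_roots \<Phi> \<Delta>" and "has_dynkin_diagram \<Delta> n E"
    and ijkl: "{i, j, k, l} \<subseteq> {1..n}" "distinct [i, j, k, l]"
    and E: "{i, k} \<in> E" "{j, k} \<in> E" "{l, k} \<in> E" "{i, j} \<notin> E" "{i, l} \<notin> E" "{j, l} \<notin> E"
  shows "\<exists>a b c d N. D4_subdiagram \<Phi> \<Delta> a b c d N"
proof -
  obtain s where s: "bij_betw s {1..n} \<Delta>"
    and cart: "\<And>p q. \<lbrakk>p \<in> {1..n}; q \<in> {1..n}; p \<noteq> q\<rbrakk> \<Longrightarrow>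
      cartan_int (s p) (s q) = (if {p, q} \<in> E then -1 else 0)"
    using assms(3) unfolding has_dynkin_diagram_def by blast
  have mem: "s p \<in> \<Delta>" if "p \<in> {i, j, k, l}" for p
    using s that ijkl(1) by (auto simp: bij_betw_def)
  have nz: "s p \<noteq> 0" if "p \<in> {i, j, k, l}" for p
    using mem[OF that] rs sr by (auto simp: root_system_def simple_roots_def)
  \<comment> \<open>Vertex \<open>k\<close> is the centre; reading each bond in both directions
    gives equal lengths.\<close>
  have edge: "s p \<bullet> s p = s k \<bullet> s k \<and> s p \<bullet> s k = - (s k \<bullet> s k) / 2" if "p \<in> {i, j, l}" for p
  proof -
    have "{p, k} \<in> E" "p \<noteq> k" using that E(1-3) ijkl(2) by auto
    then have "cartan_int (s p) (s k) = -1" "cartan_int (s k) (s p) = -1"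
      using cart[of p k] cart[of k p] that ijkl(1) by (auto simp: insert_commute)
    then show ?thesis using cartan_int_eq_minus_one[of "s p" "s k"] by auto
  qed
  have nonedge: "s p \<bullet> s q = 0" if "(p, q) \<in> {(i, j), (i, l), (j, l)}" for p q
  proof -
    have "{p, q} \<notin> E" "p \<noteq> q" using that E(4-6) ijkl(2) by auto
    then have "cartan_int (s p) (s q) = 0"
      using cart[of p q] that ijkl(1) by auto
    then show ?thesis using nz[of q] that by (auto simp: cartan_int_def)
  qed
  have "D4_subdiagram \<Phi> \<Delta> (s i) (s j) (s k) (s l) (s k \<bullet> s k)"
    using rs sr mem edge nonedge by unfold_locales auto
  then show ?thesis by blast
qed

lemma D4_subdiagram_exists:
  assumes "root_system \<Phi>" "simple_roots \<Phi> \<Delta>"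
    and "(\<exists>n\<ge>4. has_dynkin_diagram \<Delta> n (D_edges n)) \<or>
         (\<exists>n\<in>{6, 7, 8}. has_dynkin_diagram \<Delta> n (E_edges n))"
  shows "\<exists>a b c d N. D4_subdiagram \<Phi> \<Delta> a b c d N"
  using assms(3)
proof (elim disjE exE bexE conjE)
  fix n :: nat assume n: "4 \<le> n" and dg: "has_dynkin_diagram \<Delta> n (D_edges n)"
  \<comment> \<open>The branch vertex is \<open>n - 2\<close>, with neighbours \<open>n - 3\<close>,
    \<open>n - 1\<close> and \<open>n\<close>; the substitution removes truncated
    subtraction.\<close>
  obtain m where m: "n = m + 4" using n le_Suc_ex by (metis add.commute)
  show ?thesis
    by (rule D4_subdiagram_of_star[OF assms(1,2) dg, of "m + 1" "m + 3" "m + 2" "m + 4"])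
      (auto simp: D_edges_def doubleton_eq_iff m)
next
  fix n :: nat assume n: "n \<in> {6, 7, 8}" and dg: "has_dynkin_diagram \<Delta> n (E_edges n)"
  \<comment> \<open>In the Bourbaki labelling of type E, vertex 4 is the branch vertex, with
    neighbours 2, 3 and 5.\<close>
  show ?thesis
    by (rule D4_subdiagram_of_star[OF assms(1,2) dg, of 2 3 4 5])
      (use n in \<open>auto simp: E_edges_def doubleton_eq_iff\<close>)
qed

theorem theorem1p30:
  fixes \<Phi> \<Delta> I :: "'a::euclidean_space set"
  assumes "root_system \<Phi>"
    and "simple_roots \<Phi> \<Delta>"
    and "(\<exists>n\<ge>4. has_dynkin_diagram \<Delta> n (D_edges n)) \<or>
         (\<exists>n\<in>{6, 7, 8}. has_dynkin_diagram \<Delta> n (E_edges n))"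
    and "root_ideal \<Phi> \<Delta> I"
  shows "(I \<subseteq> height_ideal \<Phi> \<Delta> 4 \<longrightarrow>
            \<not> supersolvable (span \<Phi>) (ideal_arrangement \<Phi> \<Delta> I)) \<and>
         (I \<subseteq> height_ideal \<Phi> \<Delta> 5 \<longrightarrow>
            \<not> inductively_factored (span \<Phi>) (ideal_arrangement \<Phi> \<Delta> I))"
proof -
  obtain a b c d N where "D4_subdiagram \<Phi> \<Delta> a b c d N"
    using D4_subdiagram_exists[OF assms(1-3)] by blast
  then interpret D4_subdiagram \<Phi> \<Delta> a b c d N .
  \<comment> \<open>Roots of height below \<open>t\<close> cannot belong to an ideal inside
    \<open>height_ideal \<Phi> \<Delta> t\<close>, so their hyperplanes survive.\<close>
  have avoid: "F \<subseteq> P - I"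
    if "I \<subseteq> height_ideal \<Phi> \<Delta> t" "F \<subseteq> F1 \<union> F2 \<union> F3" "\<And>\<alpha>. \<alpha> \<in> F \<Longrightarrow> ht \<Delta> \<alpha> < real t" for F t
    using that frames_positive(1) by (force simp: height_ideal_def)
  have "F1 \<union> F3 \<subseteq> P - I" if "I \<subseteq> height_ideal \<Phi> \<Delta> 4"
    using frames_positive(2) by (intro avoid[OF that]) auto
  moreover have "F2 \<union> F3 \<subseteq> P - I" if "I \<subseteq> height_ideal \<Phi> \<Delta> 5"
    using frames_positive(3) by (intro avoid[OF that]) auto
  ultimately show ?thesis
    unfolding ideal_arrangement_def
    using not_supersolvable[of "P - I"] not_inductively_factored[of "P - I"] by blast
qed

end
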